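(* We may fix a basis for the matrices in $\mathcal{M}_k^j(\rho^2)$ such that $G=\Omega_j\,\mathrm{diag}\{x_1,\dots,x_k\}$, where $x_r$, $r=1,\dots,k$, are $k$-th roots of unity.
   Context: Non-singular monad matrices are $(A,B,C,D)$ with $A\in GL(k,\mathbb{C})$, $B\in Mat_{k\times k}(\mathbb{C})$, $C\in Mat_{k\times 2}(\mathbb{C})$, $D\in Mat_{2\times k}(\mathbb{C})$, satisfying $[A,B]+CD=0$ and the full-rank conditions ($\begin{pmatrix}A-y\mathbb{1}_k\\ B-x\mathbb{1}_k\\ D\end{pmatrix}$ injective and $\begin{pmatrix}x\mathbb{1}_k-B & A-y\mathbb{1}_k & C\end{pmatrix}$ surjective for all $x,y\in\mathbb{C}$), considered up to $(A,B,C,D)\sim(hAh^{-1},hBh^{-1},hC,Dh^{-1})$, $h\in GL(k,\mathbb{C})$. Here $j\in\mathbb{Z}_{2k}$ is even, and $\mathcal{M}_k^j(\rho^2)$ is the set of such matrices for which there is $G\in GL(k,\mathbb{C})$ with $e^{\imath\frac{2j\pi}{k}}A=GAG^{-1}$, $e^{\imath\frac{2\pi}{k}}B=GBG^{-1}$, $e^{\imath\frac{\pi}{k}}C=GC\,\mathrm{adj}(\sigma_{2j\pi/k})$, $e^{\imath\frac{\pi}{k}}D=\sigma_{2j\pi/k}DG^{-1}$, where $\sigma_\varphi=\mathrm{diag}(e^{-\imath\frac{3\varphi}{4}},e^{-\imath\frac{\varphi}{4}})$ and $\mathrm{adj}(\sigma)=\det(\sigma)\sigma^{-1}$. $\Omega_j=e^{\imath\frac{(2-j)\pi}{2k}}$.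 *)

theory Defs
  imports "HOL-Analysis.Analysis"
begin

text \<open>Scalar multiple of a matrix (as the matrix product with a scalar matrix).\<close>
definition cscal :: "complex \<Rightarrow> complex^'n^'m \<Rightarrow> complex^'n^'m" where
  "cscal c M = (\<chi> i j. c * M $ i $ j)"

text \<open>sigma_phi = diag(exp(-i 3 phi/4), exp(-i phi/4))\<close>
definition sigma :: "real \<Rightarrow> complex^2^2" where
  "sigma \<phi> = (\<chi> a b. if a = b then
       (if a = 1 then exp (- \<i> * of_real (3 * \<phi> / 4)) else exp (- \<i> * of_real (\<phi> / 4)))
     else 0)"

text \<open>adj(s) = det(s) s^{-1}\<close>
definition adjm :: "complex^2^2 \<Rightarrow> complex^2^2" where
  "adjm s = cscal (det s) (matrix_inv s)"

text \<open>Non-singular monad matrices (A,B,C,D), with k = CARD('k).\<close>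
definition nonsingular_monad ::
  "complex^'k^'k \<Rightarrow> complex^'k^'k \<Rightarrow> complex^2^'k \<Rightarrow> complex^'k^2 \<Rightarrow> bool" where
  "nonsingular_monad A B C D \<longleftrightarrow>
     invertible A \<and>
     A ** B - B ** A + C ** D = 0 \<and>
     (\<forall>x y :: complex.
        inj (\<lambda>v :: complex^'k. ((A - mat y) *v v, (B - mat x) *v v, D *v v)) \<and>
        (\<forall>z :: complex^'k. \<exists>u v :: complex^'k. \<exists>w :: complex^2.
            (mat x - B) *v u + (A - mat y) *v v + C *v w = z))"

text \<open>G realises the Z_{2k}-symmetry rho^2 with parameter j on (A,B,C,D).\<close>
definition symm_witness ::
  "int \<Rightarrow> complex^'k^'k \<Rightarrow> complex^'k^'k \<Rightarrow> complex^'k^'k \<Rightarrow> complex^2^'k \<Rightarrow> complex^'k^2 \<Rightarrow> bool" where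
  "symm_witness j G A B C D \<longleftrightarrow>
     (let k = real CARD('k); \<phi> = 2 * real_of_int j * pi / k in
     invertible G \<and>
     cscal (exp (\<i> * of_real (2 * real_of_int j * pi / k))) A = G ** A ** matrix_inv G \<and>
     cscal (exp (\<i> * of_real (2 * pi / k))) B = G ** B ** matrix_inv G \<and>
     cscal (exp (\<i> * of_real (pi / k))) C = G ** C ** adjm (sigma \<phi>) \<and>
     cscal (exp (\<i> * of_real (pi / k))) D = sigma \<phi> ** D ** matrix_inv G)"

definition Omega :: "int \<Rightarrow> nat \<Rightarrow> complex" where
  "Omega j k = exp (\<i> * of_real ((2 - real_of_int j) * pi / (2 * real k)))"

end

theory Submission
  imports Defs "HOL-Computational_Algebra.Fundamental_Theorem_Algebra"
begin

text \<open>\<open>G\<^sup>k\<close> commutes with \<open>A\<close> and \<open>B\<close>, since the factors by which \<open>G\<close> twists them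
  are \<open>k\<close>-th roots of unity, and \<open>D G\<^sup>k = \<Omega>\<^sub>j\<^sup>k D\<close>, since the \<open>k\<close>-th powers of
  \<open>\<sigma>\<close> and of \<open>exp (i\<pi>/k)\<close> combine to \<open>\<Omega>\<^sub>j\<^sup>k\<close>. The image of \<open>G\<^sup>k - \<Omega>\<^sub>j\<^sup>k\<close> is
  thus invariant under \<open>A\<close> and \<open>B\<close> and killed by \<open>D\<close>; there \<open>[A, B] = -C D\<close> vanishes,
  so a nonzero image would contain a common eigenvector of \<open>A\<close> and \<open>B\<close> in the kernel
  of \<open>D\<close>, contradicting the injectivity condition. Hence \<open>G\<^sup>k = \<Omega>\<^sub>j\<^sup>k\<close>, and \<open>G\<close> is
  diagonalisable with eigenvalues \<open>\<Omega>\<^sub>j x\<^sub>r\<close>, \<open>x\<^sub>r\<^sup>k = 1\<close>.\<close>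

section \<open>Matrix preliminaries\<close>

lemma matrix_vector_mult_mat: "mat y *v v = y *s (v :: 'a::semiring_1^'n)"
proof -
  have "(\<Sum>j\<in>UNIV. (if i = j then y else 0) * v $ j) = y * v $ i" for i
    by (simp add: if_distrib[of "\<lambda>x. x * v $ _"] cong: if_cong)
  then show ?thesis
    by (simp add: vec_eq_iff matrix_vector_mult_def mat_def)
qed

lemma funpow_matrix_vector_add:
  fixes M :: "'a::field^'n^'n"
  shows "((*v) M ^^ n) (u + v) = ((*v) M ^^ n) u + ((*v) M ^^ n) v"
  by (induction n) (simp_all add: vec.add)

lemma funpow_matrix_vector_scale:
  fixes M :: "'a::field^'n^'n"
  shows "((*v) M ^^ n) (a *s u) = a *s ((*v) M ^^ n) u"
  by (induction n) (simp_all add: vec.scale)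

lemma matrix_inv_inverse:
  fixes P :: "'a::semiring_1^'n^'n"
  assumes "invertible P"
  shows "P ** matrix_inv P = mat 1" and "matrix_inv P ** P = mat 1"
  using someI_ex[OF assms[unfolded invertible_def]] by (simp_all add: matrix_inv_def)

lemma matrix_inv_matrix_inv:
  fixes P :: "'a::semiring_1^'n^'n"
  assumes "invertible P"
  shows "invertible (matrix_inv P)" and "matrix_inv (matrix_inv P) = P"
proof -
  show inv: "invertible (matrix_inv P)"
    using matrix_inv_inverse[OF assms] unfolding invertible_def by blast
  have "matrix_inv (matrix_inv P) = (P ** matrix_inv P) ** matrix_inv (matrix_inv P)"
    by (simp add: matrix_inv_inverse[OF assms])
  also have "\<dots> = P"
    by (simp only: matrix_mul_assoc[symmetric] matrix_inv_inverse[OF inv] matrix_mul_rid)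
  finally show "matrix_inv (matrix_inv P) = P" .
qed

definition diag_mat :: "('n \<Rightarrow> 'a::zero) \<Rightarrow> 'a^'n^'n" where
  "diag_mat d = (\<chi> r s. if r = s then d r else 0)"

lemma similar_diag_mat:
  fixes M P :: "'a::semiring_1^'n^'n"
  assumes "invertible P" and "M ** P = P ** diag_mat d"
  shows "matrix_inv P ** M ** matrix_inv (matrix_inv P) = diag_mat d"
proof -
  have "matrix_inv P ** M ** matrix_inv (matrix_inv P) = matrix_inv P ** (M ** P)"
    by (simp add: matrix_inv_matrix_inv(2)[OF assms(1)] matrix_mul_assoc)
  also have "\<dots> = diag_mat d"
    by (simp add: assms(2) matrix_mul_assoc matrix_inv_inverse[OF assms(1)])
  finally show ?thesis .
qed

section \<open>Polynomials evaluated at a matrix\<close>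

text \<open>\<open>poly_mv p M v = p(M) v\<close>, evaluated by Horner's scheme.\<close>
definition poly_mv :: "'a::field poly \<Rightarrow> 'a^'n^'n \<Rightarrow> 'a^'n \<Rightarrow> 'a^'n" where
  "poly_mv p M = fold_coeffs (\<lambda>a F u. a *s u + M *v F u) p (\<lambda>u. 0)"

lemma poly_mv_0 [simp]: "poly_mv 0 M v = 0"
  by (simp add: poly_mv_def)

lemma poly_mv_pCons [simp]: "poly_mv (pCons a p) M v = a *s v + M *v poly_mv p M v"
  by (cases "p = 0 \<and> a = 0") (auto simp: poly_mv_def)

lemma poly_mv_1 [simp]: "poly_mv 1 M v = v"
  by (simp add: one_pCons)

lemma poly_mv_linear_factor: "poly_mv [:-a, 1:] M v = M *v v - a *s v"
  by simp

lemma poly_mv_add: "poly_mv (p + q) M v = poly_mv p M v + poly_mv q M v"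
  by (induction p q rule: poly_induct2) (simp_all add: vec.add vec.scale_left_distrib algebra_simps)

lemma poly_mv_smult: "poly_mv (smult c p) M v = c *s poly_mv p M v"
  by (induction p) (simp_all add: vec.scale vec.scale_right_distrib)

lemma poly_mv_mult: "poly_mv (p * q) M v = poly_mv p M (poly_mv q M v)"
  by (induction p) (simp_all add: poly_mv_add poly_mv_smult)

lemma poly_mv_sum: "poly_mv (\<Sum>i\<in>I. f i) M v = (\<Sum>i\<in>I. poly_mv (f i) M v)"
  by (induction I rule: infinite_finite_induct) (simp_all add: poly_mv_add)

lemma poly_mv_monom: "poly_mv (monom a n) M v = a *s ((*v) M ^^ n) v"
  by (induction n) (simp_all add: monom_0 monom_Suc vec.scale)

lemma poly_mv_in_subspace:
  assumes "vec.subspace S" and "\<forall>v\<in>S. M *v v \<in> S" and "w \<in> S"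
  shows "poly_mv p M w \<in> S"
  by (induction p) (use assms in \<open>simp_all add: vec.subspace_0 vec.subspace_add vec.subspace_scale\<close>)

text \<open>Any \<open>k + 1\<close> iterates \<open>M\<^sup>i w\<close> are linearly dependent; indexing them by
  \<^typ>\<open>'n option\<close> lets the dependency be read off the columns of a matrix.\<close>
lemma poly_mv_annihilator_exists:
  fixes M :: "'a::field^'n^'n"
  shows "\<exists>p. p \<noteq> 0 \<and> poly_mv p M w = 0"
proof -
  obtain e :: "'n option \<Rightarrow> nat" where e: "inj e"
    using finite_imp_inj_to_nat_seg[of "UNIV :: 'n option set"] by blast
  define W :: "'a^'n option^'n" where "W = (\<chi> i t. (((*v) M ^^ e t) w) $ i)"
  have col: "column t W = ((*v) M ^^ e t) w" for t
    by (simp add: W_def column_def vec_eq_iff)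
  have "\<nexists>B :: 'a^'n^'n option. B ** W = mat 1"
  proof
    assume "\<exists>B :: 'a^'n^'n option. B ** W = mat 1"
    then obtain B :: "'a^'n^'n option" where "B ** W = mat 1" by blast
    then have "range ((*v) B) = UNIV"
      by (metis matrix_vector_mul_assoc matrix_vector_mul_lid surj_def)
    then have "vec.dim (UNIV :: ('a^'n option) set) \<le> vec.dim (UNIV :: ('a^'n) set)"
      using vec.dim_image_le[OF matrix_vector_mul_linear_gen, of B UNIV] by simp
    then have "CARD('n option) \<le> CARD('n)" by (simp only: vec_dim_card)
    then show False by simp
  qed
  then obtain c t0 where c: "(\<Sum>t\<in>UNIV. c t *s column t W) = 0" and t0: "c t0 \<noteq> 0"
    using matrix_left_invertible_independent_columns[of W] by blast
  define p where "p = (\<Sum>t\<in>UNIV. monom (c t) (e t))"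
  have "coeff p (e t0) = (\<Sum>t\<in>UNIV. if t = t0 then c t else 0)"
    unfolding p_def coeff_sum coeff_monom
    by (intro sum.cong refl) (use e in \<open>auto simp: inj_eq\<close>)
  with t0 have "p \<noteq> 0" by auto
  moreover have "poly_mv p M w = 0"
    using c by (simp add: p_def poly_mv_sum poly_mv_monom col)
  ultimately show ?thesis by blast
qed

text \<open>Split off linear factors \<open>x - z\<close> of the annihilator (fundamental theorem of algebra)
  until the vector is killed: the last nonzero image is an eigenvector.\<close>
lemma eigenvector_of_annihilated_vector:
  fixes M :: "complex^'n^'n"
  assumes S: "vec.subspace S" and inv: "\<forall>v\<in>S. M *v v \<in> S"
    and w: "w \<in> S" "w \<noteq> 0" and p: "p \<noteq> 0" "poly_mv p M w = 0"
  shows "\<exists>u\<in>S. u \<noteq> 0 \<and> (\<exists>y. M *v u = y *s u)"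
  using p
proof (induction "degree p" arbitrary: p)
  case 0
  then obtain c where "p = [:c:]" "c \<noteq> 0"
    by (metis degree_0_id pCons_0_0)
  with 0 w have False by simp
  then show ?case ..
next
  case (Suc n)
  then have "\<not> constant (poly p)" by (simp add: constant_degree)
  then obtain z where "poly p z = 0" using fundamental_theorem_of_algebra by blast
  then obtain q where pq: "p = [:-z, 1:] * q" by (metis dvdE poly_eq_0_iff_dvd)
  with Suc.prems have "q \<noteq> 0" by auto
  then have "degree p = degree [:-z, 1:] + degree q"
    unfolding pq by (intro degree_mult_eq) auto
  with Suc.hyps(2) have "n = degree q" by simp
  define u where "u = poly_mv q M w"
  have "poly_mv [:-z, 1:] M u = 0"
    using Suc.prems by (simp only: pq poly_mv_mult u_def)
  then have "M *v u = z *s u"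
    by (simp only: poly_mv_linear_factor right_minus_eq)
  have "u \<in> S"
    unfolding u_def using S inv w(1) by (rule poly_mv_in_subspace)
  show ?case
  proof (cases "u = 0")
    case True
    then have "poly_mv q M w = 0" by (simp add: u_def)
    then show ?thesis by (rule Suc.hyps(1)[OF \<open>n = degree q\<close> \<open>q \<noteq> 0\<close>])
  next
    case False
    then show ?thesis using \<open>u \<in> S\<close> \<open>M *v u = z *s u\<close> by blast
  qed
qed

lemma eigenvector_in_invariant_subspace:
  fixes M :: "complex^'n^'n"
  assumes "vec.subspace S" and "\<forall>v\<in>S. M *v v \<in> S" and "S \<noteq> {0}"
  shows "\<exists>u\<in>S. u \<noteq> 0 \<and> (\<exists>y. M *v u = y *s u)"
proof -
  obtain w where "w \<in> S" "w \<noteq> 0"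
    using assms(3) vec.subspace_0[OF assms(1)] by blast
  moreover obtain p where "p \<noteq> 0" "poly_mv p M w = 0"
    using poly_mv_annihilator_exists by blast
  ultimately show ?thesis
    by (rule eigenvector_of_annihilated_vector[OF assms(1,2)])
qed

section \<open>Diagonalisability\<close>

lemma poly_eq_0_if_roots_exceed_degree:
  fixes p :: "'a::idom poly"
  assumes "degree p < card R" and "\<forall>z\<in>R. poly p z = 0"
  shows "p = 0"
proof (rule ccontr)
  assume "p \<noteq> 0"
  then have "card R \<le> card {z. poly p z = 0}"
    using assms(2) by (intro card_mono poly_roots_finite) auto
  also have "\<dots> \<le> degree p"
    using \<open>p \<noteq> 0\<close> by (rule card_poly_roots_bound)
  finally show False
    using assms(1) by simp
qed

lemma linear_factor_synthetic_div:
  fixes P :: "'a::comm_ring_1 poly"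
  assumes "poly P z = 0"
  shows "[:-z, 1:] * synthetic_div P z = P"
  using synthetic_div_correct'[of z P] assms by simp

text \<open>Lagrange interpolation: if \<open>P\<close> has \<open>deg P\<close> distinct roots \<open>R\<close>, the quotients
  \<open>P / (x - z)\<close>, \<open>z \<in> R\<close>, normalised to take the value \<open>1\<close> at \<open>z\<close>, add up to \<open>1\<close>.\<close>
lemma synthetic_div_partition_of_unity:
  fixes P :: "'a::field poly"
  assumes deg: "0 < degree P" and card: "card R = degree P" and roots: "\<forall>z\<in>R. poly P z = 0"
  shows "(\<Sum>z\<in>R. smult (inverse (poly (synthetic_div P z) z)) (synthetic_div P z)) = 1"
proof -
  define q where "q z = synthetic_div P z" for z
  have "finite R"
    using deg card by (metis card.infinite less_irrefl)
  have deg_q: "degree (q z) = degree P - 1" for z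
    by (simp add: q_def degree_synthetic_div)
  have q_vanish: "poly (q z) w = 0" if "z \<in> R" "w \<in> R" "w \<noteq> z" for z w
  proof -
    have "poly P w = (w - z) * poly (q z) w"
      by (subst linear_factor_synthetic_div[of P z, symmetric]) (use roots that in \<open>simp_all add: q_def algebra_simps\<close>)
    with roots that show ?thesis by simp
  qed
  have q_nonvanish: "poly (q z) z \<noteq> 0" if "z \<in> R" for z
  proof
    assume "poly (q z) z = 0"
    with q_vanish that have "\<forall>w\<in>R. poly (q z) w = 0" by blast
    then have "q z = 0"
      using card deg deg_q by (intro poly_eq_0_if_roots_exceed_degree) auto
    then show False
      using linear_factor_synthetic_div[of P z] roots that deg by (simp add: q_def)
  qed
  define Q where "Q = (\<Sum>z\<in>R. smult (inverse (poly (q z) z)) (q z))"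
  have "poly (Q - 1) w = 0" if "w \<in> R" for w
  proof -
    have "poly Q w = (\<Sum>z\<in>R. if z = w then 1 else 0)"
      unfolding Q_def poly_sum
      by (intro sum.cong refl) (use that q_vanish q_nonvanish in auto)
    then show ?thesis
      using \<open>finite R\<close> that by simp
  qed
  moreover have "degree (Q - 1) < card R"
  proof -
    have "degree Q \<le> degree P - 1"
      unfolding Q_def by (intro degree_sum_le order.trans[OF degree_smult_le]) (simp_all add: deg_q \<open>finite R\<close>)
    then show ?thesis
      using degree_diff_le_max[of Q 1] card deg by simp
  qed
  ultimately have "Q - 1 = 0"
    by (intro poly_eq_0_if_roots_exceed_degree) auto
  then show ?thesis
    by (simp add: Q_def q_def)
qed

lemma span_eigenvectors_if_split_annihilator:
  fixes M :: "'a::field^'n^'n"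
  assumes "0 < degree P" and "card R = degree P" and roots: "\<forall>z\<in>R. poly P z = 0"
    and annihilates: "\<forall>v. poly_mv P M v = 0"
  shows "v \<in> vec.span {u. \<exists>z\<in>R. M *v u = z *s u}"
proof -
  define q where "q z = synthetic_div P z" for z
  have eigenvector: "M *v poly_mv (q z) M v = z *s poly_mv (q z) M v" if "z \<in> R" for z
  proof -
    have "poly_mv [:-z, 1:] M (poly_mv (q z) M v) = 0"
      using annihilates linear_factor_synthetic_div[of P z] roots that
      by (simp only: q_def flip: poly_mv_mult)
    then show ?thesis
      by (simp only: poly_mv_linear_factor right_minus_eq)
  qed
  have "v = poly_mv (\<Sum>z\<in>R. smult (inverse (poly (q z) z)) (q z)) M v"
    using synthetic_div_partition_of_unity[OF assms(1-3)] by (simp add: q_def)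
  also have "\<dots> = (\<Sum>z\<in>R. inverse (poly (q z) z) *s poly_mv (q z) M v)"
    by (simp add: poly_mv_sum poly_mv_smult)
  also have "\<dots> \<in> vec.span {u. \<exists>z\<in>R. M *v u = z *s u}"
    using eigenvector by (intro vec.span_sum vec.span_scale vec.span_base) auto
  finally show ?thesis .
qed

lemma invertible_if_independent_columns:
  fixes \<beta> :: "'n \<Rightarrow> 'a::field^'n"
  assumes "inj \<beta>" and "vec.independent (range \<beta>)"
  shows "invertible (\<chi> i r. \<beta> r $ i)"
  unfolding invertible_left_inverse matrix_left_invertible_independent_columns
proof (intro allI impI)
  fix c :: "'n \<Rightarrow> 'a" and r
  assume "(\<Sum>r\<in>UNIV. c r *s column r (\<chi> i r. \<beta> r $ i)) = 0"
  then have "(\<Sum>r\<in>UNIV. c r *s \<beta> r) = 0"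
    by (simp add: column_def)
  then have "(\<Sum>b\<in>range \<beta>. c (inv \<beta> b) *s b) = 0"
    using \<open>inj \<beta>\<close> by (simp add: sum.reindex)
  then have "\<forall>b\<in>range \<beta>. c (inv \<beta> b) = 0"
    using assms(2) unfolding vec.independent_explicit
    by (blast dest: spec[of _ "\<lambda>b. c (inv \<beta> b)"])
  then show "c r = 0"
    using \<open>inj \<beta>\<close> by auto
qed

lemma diagonalization_from_eigenvector_span:
  fixes M :: "'a::field^'n^'n"
  assumes "\<And>v. v \<in> vec.span {u. \<exists>z\<in>R. M *v u = z *s u}"
  shows "\<exists>(P :: 'a^'n^'n) lam. invertible P \<and> (\<forall>r. lam r \<in> R) \<and> M ** P = P ** diag_mat lam"
proof -
  define E where "E = {u. \<exists>z\<in>R. M *v u = z *s u}"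
  obtain B where B: "B \<subseteq> E" "vec.independent B" "E \<subseteq> vec.span B"
    using vec.maximal_independent_subset by blast
  have "UNIV \<subseteq> vec.span B"
    using assms vec.span_minimal[OF B(3) vec.subspace_span] unfolding E_def by auto
  then have "card B = vec.dim (UNIV :: ('a^'n) set)"
    using vec.basis_card_eq_dim[of B UNIV] B(2) by simp
  then have "card B = CARD('n)"
    by (simp only: vec_dim_card)
  moreover have "finite B"
    using B(2) vec.independent_bound_general by blast
  ultimately obtain \<beta> :: "'n \<Rightarrow> 'a^'n" where \<beta>: "bij_betw \<beta> UNIV B"
    using finite_same_card_bij[of "UNIV :: 'n set" B] by auto
  then have "\<forall>r. \<exists>z. z \<in> R \<and> M *v \<beta> r = z *s \<beta> r"
    using B(1) unfolding E_def bij_betw_def by blast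
  then obtain lam where lam: "\<And>r. lam r \<in> R" "\<And>r. M *v \<beta> r = lam r *s \<beta> r"
    by metis
  define P :: "'a^'n^'n" where "P = (\<chi> i r. \<beta> r $ i)"
  have "invertible P"
    unfolding P_def using \<beta> B(2) by (intro invertible_if_independent_columns) (auto simp: bij_betw_def)
  moreover have "M ** P = P ** diag_mat lam"
  proof -
    have "(M ** P) $ i $ r = (M *v \<beta> r) $ i" for i r
      by (simp add: matrix_matrix_mult_def matrix_vector_mult_def P_def)
    moreover have "(P ** diag_mat lam) $ i $ r = lam r * \<beta> r $ i" for i r
      by (simp add: matrix_matrix_mult_def P_def diag_mat_def if_distrib[of "\<lambda>x. _ * x"] cong: if_cong)
    ultimately show ?thesis
      using lam(2) by (simp add: vec_eq_iff mult.commute)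
  qed
  ultimately show ?thesis
    using lam(1) by auto
qed

text \<open>The roots of \<open>z\<^sup>k - c\<close> are simple when \<open>c \<noteq> 0\<close>, which is why \<open>M\<close> is diagonalisable.\<close>
lemma diagonalizable_if_power_scalar:
  fixes M :: "complex^'n^'n"
  assumes "c \<noteq> 0" and power: "\<And>v. ((*v) M ^^ CARD('n)) v = c *s v"
  shows "\<exists>(P :: complex^'n^'n) lam. invertible P \<and> (\<forall>r. lam r ^ CARD('n) = c) \<and> M ** P = P ** diag_mat lam"
proof -
  define P :: "complex poly" where "P = monom 1 CARD('n) + [:-c:]"
  define R where "R = {z. z ^ CARD('n) = c}"
  have deg: "degree P = CARD('n)"
    unfolding P_def by (subst degree_add_eq_left) (auto simp: degree_monom_eq)
  have card: "card R = CARD('n)"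
    unfolding R_def using assms(1) by (simp add: card_nth_roots)
  have roots: "\<forall>z\<in>R. poly P z = 0"
    by (simp add: P_def R_def poly_monom)
  have annihilates: "\<forall>v. poly_mv P M v = 0"
    by (simp add: P_def poly_mv_add poly_mv_monom power)
  have "v \<in> vec.span {u. \<exists>z\<in>R. M *v u = z *s u}" for v
    using span_eigenvectors_if_split_annihilator[of P R M v] deg card roots annihilates by simp
  from diagonalization_from_eigenvector_span[OF this] show ?thesis
    by (simp add: R_def)
qed

lemma diagonal_form_if_power_scalar:
  fixes M :: "complex^'n^'n"
  assumes "\<Omega> \<noteq> 0" and "\<And>v. ((*v) M ^^ CARD('n)) v = \<Omega> ^ CARD('n) *s v"
  shows "\<exists>(h :: complex^'n^'n) x. invertible h \<and> (\<forall>r. x r ^ CARD('n) = 1) \<and>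
    h ** M ** matrix_inv h = diag_mat (\<lambda>r. \<Omega> * x r)"
proof -
  from assms obtain P :: "complex^'n^'n" and lam
    where P: "invertible P" "\<forall>r. lam r ^ CARD('n) = \<Omega> ^ CARD('n)" "M ** P = P ** diag_mat lam"
    using diagonalizable_if_power_scalar[of "\<Omega> ^ CARD('n)" M] by auto
  define x where "x r = lam r / \<Omega>" for r
  have "\<forall>r. x r ^ CARD('n) = 1"
    using P(2) assms(1) by (simp add: x_def power_divide)
  moreover have "(\<lambda>r. \<Omega> * x r) = lam"
    using assms(1) by (simp add: x_def)
  ultimately show ?thesis
    using matrix_inv_matrix_inv(1)[OF P(1)] similar_diag_mat[OF P(1,3)] by auto
qed

section \<open>Nonsingular monads\<close>

lemma nonsingular_monad_commute_on_kernel_D: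
  assumes "nonsingular_monad A B C D" and "D *v v = 0"
  shows "A *v (B *v v) = B *v (A *v v)"
proof -
  have "(A ** B - B ** A + C ** D) *v v = 0"
    using assms(1) by (simp add: nonsingular_monad_def)
  then have "A *v (B *v v) - B *v (A *v v) + C *v (D *v v) = 0"
    by (simp add: matrix_vector_mult_add_rdistrib matrix_vector_mult_diff_rdistrib matrix_vector_mul_assoc)
  with assms(2) show ?thesis
    by simp
qed

lemma nonsingular_monad_no_common_eigenvector:
  assumes "nonsingular_monad A B C D"
    and "A *v z = y *s z" and "B *v z = x *s z" and "D *v z = 0"
  shows "z = 0"
proof -
  have "inj (\<lambda>v. ((A - mat y) *v v, (B - mat x) *v v, D *v v))"
    using assms(1) by (simp add: nonsingular_monad_def)
  moreover have "((A - mat y) *v z, (B - mat x) *v z, D *v z) = ((A - mat y) *v 0, (B - mat x) *v 0, D *v 0)"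
    using assms(2-4) by (simp add: matrix_vector_mult_diff_rdistrib matrix_vector_mult_mat)
  ultimately show ?thesis
    by (rule injD)
qed

text \<open>On such a subspace \<open>A\<close> and \<open>B\<close> commute, so an eigenspace of \<open>A\<close> in it is
  \<open>B\<close>-invariant and contains a common eigenvector, which the monad conditions exclude.\<close>
lemma nonsingular_monad_invariant_subspace_trivial:
  fixes A B :: "complex^'k^'k" and C :: "complex^2^'k" and D :: "complex^'k^2"
  assumes monad: "nonsingular_monad A B C D" and S: "vec.subspace S"
    and A_inv: "\<forall>v\<in>S. A *v v \<in> S" and B_inv: "\<forall>v\<in>S. B *v v \<in> S" and D_0: "\<forall>v\<in>S. D *v v = 0"
  shows "S = {0}"
proof (rule ccontr)
  assume "S \<noteq> {0}"
  then obtain u y where u: "u \<in> S" "u \<noteq> 0" "A *v u = y *s u"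
    using eigenvector_in_invariant_subspace[OF S A_inv] by blast
  define S' where "S' = {v \<in> S. A *v v = y *s v}"
  have "vec.subspace S'"
    unfolding vec.subspace_def S'_def
    using vec.subspace_0[OF S] vec.subspace_add[OF S] vec.subspace_scale[OF S]
    by (simp add: vec.add vec.scale vec.scale_right_distrib vec.scale_scale mult.commute)
  moreover have "\<forall>v\<in>S'. B *v v \<in> S'"
    using B_inv D_0 nonsingular_monad_commute_on_kernel_D[OF monad]
    by (simp add: S'_def vec.scale)
  moreover have "S' \<noteq> {0}"
    using u by (auto simp: S'_def)
  ultimately obtain z x where "z \<in> S'" "z \<noteq> 0" "B *v z = x *s z"
    using eigenvector_in_invariant_subspace by blast
  moreover from \<open>z \<in> S'\<close> have "A *v z = y *s z" and "D *v z = 0"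
    using D_0 by (simp_all add: S'_def)
  ultimately show False
    using nonsingular_monad_no_common_eigenvector[OF monad] by blast
qed

lemma nonsingular_monad_commutant_scalar:
  fixes A B :: "complex^'k^'k" and C :: "complex^2^'k" and D :: "complex^'k^2"
  assumes monad: "nonsingular_monad A B C D"
    and add: "\<And>u v. H (u + v) = H u + H v" and scale: "\<And>a u. H (a *s u) = a *s H u"
    and HA: "\<And>w. H (A *v w) = A *v H w" and HB: "\<And>w. H (B *v w) = B *v H w"
    and HD: "\<And>w. D *v H w = c *s (D *v w)"
  shows "H w = c *s w"
proof -
  define T where "T w = H w - c *s w" for w
  have "vec.subspace (range T)"
  proof -
    have "T 0 = 0"
      using scale[of 0 0] by (simp add: T_def)
    then have "0 \<in> range T"
      by (metis rangeI)
    moreover have "T u + T v = T (u + v)" and "a *s T u = T (a *s u)" for u v a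
      by (simp_all add: T_def add scale vec.scale_right_distrib vec.scale_right_diff_distrib
          vec.scale_scale mult.commute)
    ultimately show ?thesis
      unfolding vec.subspace_def by auto
  qed
  moreover have "A *v T w = T (A *v w)" and "B *v T w = T (B *v w)" and "D *v T w = 0" for w
    by (simp_all add: T_def vec.diff vec.scale HA HB HD)
  ultimately have "range T = {0}"
    using nonsingular_monad_invariant_subspace_trivial[OF monad, of "range T"] by auto
  then have "T w = 0"
    by (metis rangeI singletonD)
  then show ?thesis
    by (simp add: T_def)
qed

section \<open>The symmetry \<open>G\<close>\<close>

lemma matrix_vector_mult_cscal: "cscal c M *v v = c *s (M *v v)"
  by (simp add: vec_eq_iff matrix_vector_mult_def cscal_def sum_distrib_left mult_ac)

lemma intertwine_of_cscal_conj:
  fixes G :: "complex^'n^'n" and X :: "complex^'n^'m" and S :: "complex^'m^'m"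
  assumes "invertible G" and "cscal l X = S ** X ** matrix_inv G"
  shows "l *s (X *v (G *v w)) = S *v (X *v w)"
proof -
  have "matrix_inv G *v (G *v w) = w"
    by (simp add: matrix_vector_mul_assoc matrix_inv_inverse[OF assms(1)])
  then have "(S ** X ** matrix_inv G) *v (G *v w) = S *v (X *v w)"
    by (simp add: matrix_vector_mul_assoc[symmetric])
  then show ?thesis
    by (simp flip: assms(2) add: matrix_vector_mult_cscal)
qed

lemma intertwine_funpow:
  fixes G :: "'a::field^'n^'n" and X :: "'a^'n^'m" and S :: "'a^'m^'m"
  assumes "\<And>w. l *s (X *v (G *v w)) = S *v (X *v w)"
  shows "l ^ n *s (X *v ((*v) G ^^ n) w) = ((*v) S ^^ n) (X *v w)"
proof (induction n)
  case 0
  then show ?case by simp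
next
  case (Suc n)
  have "l ^ Suc n *s (X *v ((*v) G ^^ Suc n) w) = l ^ n *s (l *s (X *v (G *v ((*v) G ^^ n) w)))"
    by (simp only: power_Suc2 vec.scale_scale funpow.simps comp_apply)
  also have "\<dots> = S *v (l ^ n *s (X *v ((*v) G ^^ n) w))"
    by (simp add: assms vec.scale)
  finally show ?case
    using Suc.IH by simp
qed

lemma sigma_funpow_scalar:
  assumes "exp (- \<i> * of_real (3 * \<phi> / 4)) ^ n = s" and "exp (- \<i> * of_real (\<phi> / 4)) ^ n = s"
  shows "((*v) (sigma \<phi>) ^^ n) u = s *s u"
proof -
  have sigma_mult: "sigma \<phi> *v v = (\<chi> a. (if a = 1 then exp (- \<i> * of_real (3 * \<phi> / 4))
      else exp (- \<i> * of_real (\<phi> / 4))) * v $ a)" for v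
  proof -
    have "(\<Sum>b\<in>UNIV. (if a = b then z else 0) * v $ b) = z * v $ a" for a :: 2 and z
      by (simp add: if_distrib[of "\<lambda>x. x * v $ _"] cong: if_cong)
    then show ?thesis
      by (simp add: vec_eq_iff matrix_vector_mult_def sigma_def)
  qed
  have "((*v) (sigma \<phi>) ^^ n) u = (\<chi> a. (if a = 1 then exp (- \<i> * of_real (3 * \<phi> / 4)) ^ n
      else exp (- \<i> * of_real (\<phi> / 4)) ^ n) * u $ a)"
    by (induction n) (simp_all add: vec_eq_iff sigma_mult mult_ac)
  with assms show ?thesis
    by (simp add: vec_eq_iff)
qed

lemma exp_i_power_eq_neg_one_power:
  assumes "real n * t = real N * pi"
  shows "exp (\<i> * of_real t) ^ n = (-1) ^ N"
proof -
  have "exp (\<i> * of_real t) ^ n = exp (\<i> * of_real (real n * t))"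
    by (simp flip: exp_of_nat_mult add: mult_ac)
  also have "\<dots> = exp (\<i> * of_real pi) ^ N"
    unfolding assms exp_of_nat_mult[symmetric] by (simp add: mult_ac)
  finally show ?thesis
    by simp
qed

lemma exp_minus_i_power_eq_neg_one_power:
  assumes "real n * t = real N * pi"
  shows "exp (- \<i> * of_real t) ^ n = (-1) ^ N"
proof -
  have "exp (- \<i> * of_real t) ^ n = inverse (exp (\<i> * of_real t) ^ n)"
    by (simp add: exp_minus power_inverse)
  then show ?thesis
    by (simp add: exp_i_power_eq_neg_one_power[OF assms] power_inverse[symmetric])
qed

lemma twist_factor_powers:
  assumes K: "0 < K" and j: "real_of_int j = 2 * real m"
  defines "\<phi> \<equiv> 2 * real_of_int j * pi / real K"
  shows "exp (\<i> * of_real \<phi>) ^ K = 1"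
    and "exp (\<i> * of_real (2 * pi / real K)) ^ K = 1"
    and "exp (\<i> * of_real (pi / real K)) ^ K = -1"
    and "exp (- \<i> * of_real (3 * \<phi> / 4)) ^ K = (-1) ^ m"
    and "exp (- \<i> * of_real (\<phi> / 4)) ^ K = (-1) ^ m"
    and "Omega j K ^ K = - ((-1) ^ m)"
proof -
  show "exp (\<i> * of_real \<phi>) ^ K = 1"
    using exp_i_power_eq_neg_one_power[of K \<phi> "4 * m"] K by (simp add: \<phi>_def j power_mult)
  show "exp (\<i> * of_real (2 * pi / real K)) ^ K = 1"
    using exp_i_power_eq_neg_one_power[of K "2 * pi / real K" 2] K by simp
  show "exp (\<i> * of_real (pi / real K)) ^ K = -1"
    using exp_i_power_eq_neg_one_power[of K "pi / real K" 1] K by simp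
  show "exp (- \<i> * of_real (3 * \<phi> / 4)) ^ K = (-1) ^ m"
    using exp_minus_i_power_eq_neg_one_power[of K "3 * \<phi> / 4" "3 * m"] K by (simp add: \<phi>_def j power_mult)
  show "exp (- \<i> * of_real (\<phi> / 4)) ^ K = (-1) ^ m"
    using exp_minus_i_power_eq_neg_one_power[of K "\<phi> / 4" m] K by (simp add: \<phi>_def j)
  have "(2 - real_of_int j) * pi / (2 * real K) = pi / real K - real m * pi / real K"
    using K by (simp add: j field_simps)
  then have "Omega j K = exp (\<i> * of_real (pi / real K - real m * pi / real K))"
    unfolding Omega_def by (simp only:)
  also have "\<dots> = exp (\<i> * of_real (pi / real K)) * exp (- \<i> * of_real (real m * pi / real K))"
    by (simp add: algebra_simps flip: exp_add)
  finally show "Omega j K ^ K = - ((-1) ^ m)"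
    using exp_i_power_eq_neg_one_power[of K "pi / real K" 1]
      exp_minus_i_power_eq_neg_one_power[of K "real m * pi / real K" m] K
    by (simp add: power_mult_distrib)
qed

lemma symm_witness_power_scalar:
  fixes A B G :: "complex^'k^'k" and C :: "complex^2^'k" and D :: "complex^'k^2"
  assumes "0 \<le> j" and "even j" and monad: "nonsingular_monad A B C D"
    and "symm_witness j G A B C D"
  shows "((*v) G ^^ CARD('k)) w = Omega j CARD('k) ^ CARD('k) *s w"
proof -
  define K where "K = CARD('k)"
  define \<phi> where "\<phi> = 2 * real_of_int j * pi / real K"
  define H where "H = (*v) G ^^ K"
  from assms(2) obtain b where "j = 2 * b"
    by (rule evenE)
  define m where "m = nat b"
  have j: "real_of_int j = 2 * real m"
    using \<open>j = 2 * b\<close> assms(1) by (simp add: m_def)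
  have "0 < K"
    by (simp add: K_def)
  note powers = twist_factor_powers[OF this j, folded \<phi>_def]
  have G: "invertible G"
    and A: "cscal (exp (\<i> * of_real \<phi>)) A = G ** A ** matrix_inv G"
    and B: "cscal (exp (\<i> * of_real (2 * pi / real K))) B = G ** B ** matrix_inv G"
    and D: "cscal (exp (\<i> * of_real (pi / real K))) D = sigma \<phi> ** D ** matrix_inv G"
    using assms(4) unfolding symm_witness_def Let_def \<phi>_def K_def by auto
  have HA: "H (A *v w) = A *v H w" and HB: "H (B *v w) = B *v H w" for w
    using intertwine_funpow[OF intertwine_of_cscal_conj[OF G A], of K w]
      intertwine_funpow[OF intertwine_of_cscal_conj[OF G B], of K w] powers
    by (simp_all add: H_def K_def)
  have HD: "D *v H w = Omega j K ^ K *s (D *v w)" for w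
  proof -
    have "(-1) *s (D *v H w) = ((*v) (sigma \<phi>) ^^ K) (D *v w)"
      using intertwine_funpow[OF intertwine_of_cscal_conj[OF G D], of K w] powers
      by (simp add: H_def K_def)
    also have "\<dots> = (-1) ^ m *s (D *v w)"
      using powers by (intro sigma_funpow_scalar) (simp_all add: K_def)
    finally have "- (D *v H w) = (-1) ^ m *s (D *v w)"
      by simp
    then have "D *v H w = - ((-1) ^ m *s (D *v w))"
      by (metis minus_minus)
    then show ?thesis
      using powers by (simp add: K_def vec.scale_minus_left)
  qed
  have "H w = Omega j K ^ K *s w"
  proof (rule nonsingular_monad_commutant_scalar[OF monad _ _ HA HB HD])
    show "H (u + v) = H u + H v" for u v
      unfolding H_def by (rule funpow_matrix_vector_add)
    show "H (a *s u) = a *s H u" for a u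
      unfolding H_def by (rule funpow_matrix_vector_scale)
  qed
  then show ?thesis
    by (simp add: H_def K_def)
qed

theorem mainTheorem7:
  fixes A B G :: "complex^'k^'k" and C :: "complex^2^'k" and D :: "complex^'k^2"
    and j :: int
  assumes "0 \<le> j" and "j < 2 * int CARD('k)" and "even j"
    and "nonsingular_monad A B C D"
    and "symm_witness j G A B C D"
  shows "\<exists>(h :: complex^'k^'k) (x :: 'k \<Rightarrow> complex).
           invertible h \<and> (\<forall>r. x r ^ CARD('k) = 1) \<and>
           h ** G ** matrix_inv h =
             (\<chi> r s. if r = s then Omega j CARD('k) * x r else 0)"
proof -
  have "Omega j CARD('k) \<noteq> 0"
    by (simp add: Omega_def)
  from diagonal_form_if_power_scalar[OF this symm_witness_power_scalar[OF assms(1,3-5)]]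
  show ?thesis
    by (simp add: diag_mat_def)
qed

end
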